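(* Let $G$ be a finite simple connected graph with $\chi(G)=k$. Then $G$ is upper-critical if and only if $G$ is isomorphic to a complete $k$-partite graph $K_{n_1,n_2,\dots,n_k}$ for some positive integers $n_1,\dots,n_k$.
   Context: $\chi(G)$ is the chromatic number. $\overline{G}$ is the complement of $G$, and for $e\in E(\overline{G})$, $G+e$ is $G$ with the edge $e$ added. A graph $G$ is upper-critical if no edge can be added to it while preserving its chromatic number, i.e. $\{e\in E(\overline{G}) : \chi(G+e)=\chi(G)\}=\emptyset$ (equivalently, $\chi(G+e)>\chi(G)$ for all $e\in E(\overline{G})$; in particular every complete graph is upper-critical). The complete $k$-partite graph $K_{n_1,\dots,n_k}$ is the join of $k$ vertex-disjoint independent sets of cardinalities $n_1,\dots,n_k$: two vertices are adjacent if and only if they lie in different independent sets. *)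

theory Defs
  imports "Graph_Theory.Digraph_Isomorphism"
begin

text \<open>
  As usual in this library, a finite simple graph is a finite, symmetric, loop-free digraph
  whose arcs are pairs of vertices (\<^locale>\<open>pair_graph\<close>): the undirected edge joining \<open>u\<close> and
  \<open>v\<close> is represented by the two arcs \<open>(u, v)\<close> and \<open>(v, u)\<close>.
\<close>

definition proper_coloring :: "'a pair_pre_digraph \<Rightarrow> nat \<Rightarrow> ('a \<Rightarrow> nat) \<Rightarrow> bool" where
  "proper_coloring G k c \<longleftrightarrow>
     (\<forall>v \<in> pverts G. c v < k) \<and> (\<forall>(u, v) \<in> parcs G. c u \<noteq> c v)"

definition chromatic_number :: "'a pair_pre_digraph \<Rightarrow> nat" where
  "chromatic_number G = (LEAST k. \<exists>c. proper_coloring G k c)"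

definition complement_graph :: "'a pair_pre_digraph \<Rightarrow> 'a pair_pre_digraph" where
  "complement_graph G =
     \<lparr> pverts = pverts G,
       parcs = {(u, v). u \<in> pverts G \<and> v \<in> pverts G \<and> u \<noteq> v \<and> (u, v) \<notin> parcs G} \<rparr>"

text \<open>Adding an undirected edge means adding both of its orientations.\<close>

definition add_edge :: "'a pair_pre_digraph \<Rightarrow> 'a \<times> 'a \<Rightarrow> 'a pair_pre_digraph" where
  "add_edge G e =
     \<lparr> pverts = pverts G, parcs = parcs G \<union> {(fst e, snd e), (snd e, fst e)} \<rparr>"

definition upper_critical :: "'a pair_pre_digraph \<Rightarrow> bool" where
  "upper_critical G \<longleftrightarrow>
     {e \<in> parcs (complement_graph G).
        chromatic_number (add_edge G e) = chromatic_number G} = {}"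

text \<open>
  The part sizes \<open>n\<^sub>1, \<dots>, n\<^sub>k\<close> are given as a list \<open>ns\<close> of length \<open>k\<close>; the vertex \<open>(i, j)\<close> is the
  \<open>j\<close>-th vertex of the \<open>i\<close>-th part (both counted from 0).
\<close>

definition complete_multipartite :: "nat list \<Rightarrow> (nat \<times> nat) pair_pre_digraph" where
  "complete_multipartite ns =
     (let V = {(i, j). i < length ns \<and> j < ns ! i}
      in \<lparr> pverts = V, parcs = {(x, y). x \<in> V \<and> y \<in> V \<and> fst x \<noteq> fst y} \<rparr>)"

end

theory Submission
  imports Defs
begin

text \<open>
  Both conditions say that some map \<open>c\<close> from the vertices onto \<open>{..<k}\<close> has the property that two
  vertices are adjacent exactly when \<open>c\<close> separates them; the fibres of \<open>c\<close> are then the parts.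

  If \<open>G\<close> is upper-critical, any proper colouring \<open>c\<close> with \<open>\<chi>(G)\<close> colours is such a map: an edge
  added between nonadjacent vertices of different colours would leave \<open>c\<close> proper, hence would not
  change the chromatic number. Every colour is used, since otherwise one colour could be saved
  (\<open>optimal_coloring_surj\<close>), so all parts are nonempty.

  Conversely, let \<open>c\<close> be such a map. Nonadjacent vertices \<open>u\<close> and \<open>v\<close> lie in the same part, and
  once they are joined, \<open>u\<close> and \<open>v\<close> together with one vertex from each of the other \<open>k - 1\<close> parts
  form a clique with \<open>k + 1\<close> vertices, which rules out every colouring with \<open>k\<close> colours.

  The translation between such maps and isomorphisms with a complete multipartite graph numbers
  the vertices within each fibre in one direction, and reads off the index of the part in the other.
\<close>

section \<open>Chromatic number and added edges\<close>

lemma chromatic_number_le: "proper_coloring G k c \<Longrightarrow> chromatic_number G \<le> k"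
  unfolding chromatic_number_def by (rule Least_le) blast

lemma optimal_coloring_exists:
  assumes "pair_digraph G"
  shows "\<exists>c. proper_coloring G (chromatic_number G) c"
proof -
  interpret pair_digraph G by fact
  obtain c :: "'a \<Rightarrow> nat" where c: "bij_betw c (pverts G) {0..<card (pverts G)}"
    using ex_bij_betw_finite_nat pair_finite_verts by blast
  have "c u \<noteq> c v" if "(u, v) \<in> parcs G" for u v
    using that c pair_no_loops[OF that] in_arcsD1 in_arcsD2
    by (auto simp: bij_betw_def inj_on_def)
  then have "proper_coloring G (card (pverts G)) c"
    using c by (auto simp: proper_coloring_def bij_betw_def)
  then have "\<exists>k. \<exists>c. proper_coloring G k c" by blast
  then show ?thesis unfolding chromatic_number_def by (rule LeastI_ex)
qed

text \<open>A proper colouring that misses a colour can be turned into one with fewer colours.\<close>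

lemma optimal_coloring_surj:
  assumes "pair_wf_digraph G" and c: "proper_coloring G (chromatic_number G) c"
  shows "c ` pverts G = {..<chromatic_number G}"
proof (rule ccontr)
  interpret pair_wf_digraph G by fact
  let ?k = "chromatic_number G"
  assume "c ` pverts G \<noteq> {..<?k}"
  moreover have "c ` pverts G \<subseteq> {..<?k}"
    using c by (auto simp: proper_coloring_def)
  ultimately obtain i where i: "i < ?k" "i \<notin> c ` pverts G" by blast
  \<comment> \<open>Renaming the last colour to the unused colour \<open>i\<close> saves a colour. If \<open>i\<close> is itself the last
    colour, nothing is renamed.\<close>
  define c' where "c' = (\<lambda>v. if c v = ?k - 1 then i else c v)"
  have "c' v < ?k - 1" if "v \<in> pverts G" for v
  proof -
    have "c v < ?k" "c v \<noteq> i" using c i that by (auto simp: proper_coloring_def)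
    then show ?thesis using i(1) by (auto simp: c'_def)
  qed
  moreover have "c' u \<noteq> c' v" if "(u, v) \<in> parcs G" for u v
  proof -
    have "c u \<noteq> i" "c v \<noteq> i" "c u \<noteq> c v"
      using that i(2) c in_arcsD1[OF that] in_arcsD2[OF that] by (auto simp: proper_coloring_def)
    then show ?thesis by (auto simp: c'_def)
  qed
  ultimately have "proper_coloring G (?k - 1) c'"
    by (auto simp: proper_coloring_def)
  then show False using chromatic_number_le i(1) by fastforce
qed

lemma clique_card_le_colors:
  assumes c: "proper_coloring G k c" and "C \<subseteq> pverts G"
    and clique: "\<And>x y. x \<in> C \<Longrightarrow> y \<in> C \<Longrightarrow> x \<noteq> y \<Longrightarrow> (x, y) \<in> parcs G"
  shows "card C \<le> k"
proof -
  have "inj_on c C"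
    using c clique by (fastforce simp: inj_on_def proper_coloring_def)
  moreover have "c ` C \<subseteq> {..<k}"
    using c \<open>C \<subseteq> pverts G\<close> by (auto simp: proper_coloring_def)
  ultimately have "card C \<le> card {..<k}" by (intro card_inj_on_le) auto
  then show ?thesis by simp
qed

lemma pair_digraph_add_edge:
  assumes "pair_digraph G" and "e \<in> parcs (complement_graph G)"
  shows "pair_digraph (add_edge G e)"
proof -
  interpret pair_digraph G by fact
  show ?thesis
    using assms(2) in_arcsD1 in_arcsD2 pair_no_loops
      pair_finite_verts pair_finite_arcs
    by unfold_locales (auto simp: add_edge_def complement_graph_def)
qed

lemma chromatic_number_add_edge_ge:
  assumes "pair_digraph G" and "e \<in> parcs (complement_graph G)"
  shows "chromatic_number G \<le> chromatic_number (add_edge G e)"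
proof -
  obtain c where "proper_coloring (add_edge G e) (chromatic_number (add_edge G e)) c"
    using optimal_coloring_exists pair_digraph_add_edge assms by blast
  then have "proper_coloring G (chromatic_number (add_edge G e)) c"
    by (auto simp: proper_coloring_def add_edge_def)
  then show ?thesis by (rule chromatic_number_le)
qed

section \<open>Upper-critical graphs and multipartite colourings\<close>

text \<open>
  The fibres of \<open>c\<close> are the parts of a complete multipartite graph on the vertices of \<open>G\<close>. Labelling
  the parts by natural numbers makes \<open>c\<close> a colouring at the same time.
\<close>

definition multipartite_coloring :: "'a pair_pre_digraph \<Rightarrow> ('a \<Rightarrow> nat) \<Rightarrow> bool" where
  "multipartite_coloring G c \<longleftrightarrow>
     parcs G = {(u, v). u \<in> pverts G \<and> v \<in> pverts G \<and> c u \<noteq> c v}"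

text \<open>
  An edge missing between two colour classes could be added without spoiling the colouring, hence
  without raising the chromatic number.
\<close>

lemma upper_critical_imp_multipartite_coloring:
  assumes "pair_digraph G" and crit: "upper_critical G"
    and c: "proper_coloring G (chromatic_number G) c"
  shows "multipartite_coloring G c"
proof -
  interpret pair_digraph G by fact
  have "(u, v) \<in> parcs G" if uv: "u \<in> pverts G" "v \<in> pverts G" "c u \<noteq> c v" for u v
  proof (rule ccontr)
    assume "(u, v) \<notin> parcs G"
    then have e: "(u, v) \<in> parcs (complement_graph G)"
      using uv by (auto simp: complement_graph_def)
    have "proper_coloring (add_edge G (u, v)) (chromatic_number G) c"
      using c uv by (auto simp: proper_coloring_def add_edge_def)
    then have "chromatic_number (add_edge G (u, v)) = chromatic_number G"
      using chromatic_number_add_edge_ge[OF assms(1) e] chromatic_number_le[of "add_edge G (u, v)"]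
      by (intro le_antisym)
    then show False using crit e by (auto simp: upper_critical_def)
  qed
  moreover have "u \<in> pverts G \<and> v \<in> pverts G \<and> c u \<noteq> c v" if "(u, v) \<in> parcs G" for u v
    using that c in_arcsD1[OF that] in_arcsD2[OF that] by (auto simp: proper_coloring_def)
  ultimately show ?thesis unfolding multipartite_coloring_def by blast
qed

text \<open>
  An added edge lies inside a part, so its two ends and one vertex from every other part form a
  clique with more vertices than there are colours.
\<close>

lemma multipartite_coloring_imp_upper_critical:
  assumes "pair_digraph G" and c: "multipartite_coloring G c"
    and surj: "c ` pverts G = {..<chromatic_number G}"
  shows "upper_critical G"
proof -
  let ?k = "chromatic_number G"
  have "chromatic_number (add_edge G (u, v)) \<noteq> ?k"
    if e: "(u, v) \<in> parcs (complement_graph G)" for u v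
  proof
    assume eq: "chromatic_number (add_edge G (u, v)) = ?k"
    obtain d where d: "proper_coloring (add_edge G (u, v)) ?k d"
      using optimal_coloring_exists[OF pair_digraph_add_edge[OF assms(1) e]] eq by auto
    have uv: "u \<in> pverts G" "v \<in> pverts G" "u \<noteq> v" "c u = c v"
      using e c by (auto simp: complement_graph_def multipartite_coloring_def)
    have "\<exists>x. x \<in> pverts G \<and> c x = i" if "i < ?k" for i
    proof -
      have "i \<in> c ` pverts G" using surj that by simp
      then show ?thesis by blast
    qed
    then obtain s where s: "\<And>i. i < ?k \<Longrightarrow> s i \<in> pverts G \<and> c (s i) = i" by metis
    \<comment> \<open>A system of representatives of the parts in which \<open>u\<close> represents its own part, so that only
      the new edge joins two vertices of the same part.\<close>
    define r where "r = s (c u := u)"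
    have r: "r i \<in> pverts G" "c (r i) = i" if "i < ?k" for i
      using s that uv by (auto simp: r_def)
    have v: "r i = u \<or> c (r i) \<noteq> c v" if "i < ?k" for i
      using r(2)[OF that] uv(4) by (auto simp: r_def)
    have "inj_on r {..<?k}" using r(2) by (metis inj_onI lessThan_iff)
    moreover have "v \<notin> r ` {..<?k}" using v uv(3) by auto
    ultimately have "card (insert v (r ` {..<?k})) = Suc ?k"
      by (simp add: card_image)
    moreover have "card (insert v (r ` {..<?k})) \<le> ?k"
    proof (rule clique_card_le_colors[OF d])
      show "insert v (r ` {..<?k}) \<subseteq> pverts (add_edge G (u, v))"
        using r uv by (auto simp: add_edge_def)
    next
      fix x y
      assume "x \<in> insert v (r ` {..<?k})" "y \<in> insert v (r ` {..<?k})" "x \<noteq> y"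
      then have "x \<in> pverts G \<and> y \<in> pverts G \<and>
          (c x \<noteq> c y \<or> (x, y) = (u, v) \<or> (x, y) = (v, u))"
      proof (cases "x = v \<or> y = v")
        case True
        then show ?thesis
          using \<open>x \<in> _\<close> \<open>y \<in> _\<close> \<open>x \<noteq> y\<close> r(1) uv(2) v by fastforce
      next
        case False
        then obtain i j where "i < ?k" "j < ?k" "x = r i" "y = r j"
          using \<open>x \<in> _\<close> \<open>y \<in> _\<close> by blast
        then show ?thesis using \<open>x \<noteq> y\<close> r by auto
      qed
      then show "(x, y) \<in> parcs (add_edge G (u, v))"
        using c by (auto simp: add_edge_def multipartite_coloring_def)
    qed
    ultimately show False by simp
  qed
  then show ?thesis by (auto simp: upper_critical_def)
qed

section \<open>Isomorphism with a complete multipartite graph\<close>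

text \<open>
  The isomorphism sends \<open>v\<close> to the pair of its part \<open>c v\<close> and its number within that part, for an
  arbitrary enumeration of each part. Surjectivity of \<open>c\<close> is what makes the part sizes positive.
\<close>

lemma multipartite_coloring_imp_iso_complete_multipartite:
  assumes "pair_digraph G" and c: "multipartite_coloring G c"
    and surj: "c ` pverts G = {..<k}"
  shows "\<exists>ns. length ns = k \<and> (\<forall>n \<in> set ns. 0 < n) \<and>
           digraph_iso (with_proj G) (with_proj (complete_multipartite ns))"
proof -
  interpret pair_digraph G by fact
  define P where "P i = {v \<in> pverts G. c v = i}" for i
  have fin: "finite (P i)" for i using pair_finite_verts by (simp add: P_def)
  define ns where "ns = map (\<lambda>i. card (P i)) [0..<k]"
  have "P i \<noteq> {}" if "i < k" for i
  proof -
    have "i \<in> c ` pverts G" using surj that by simp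
    then show ?thesis by (auto simp: P_def)
  qed
  then have pos: "\<forall>n \<in> set ns. 0 < n"
    using fin by (auto simp: ns_def card_gt_0_iff)
  have "\<forall>i. \<exists>g. bij_betw g (P i) {0..<card (P i)}"
    using ex_bij_betw_finite_nat fin by blast
  then obtain g where g: "\<And>i. bij_betw (g i) (P i) {0..<card (P i)}" by metis
  define f where "f v = (c v, g (c v) v)" for v
  let ?V = "{(i, j). i < length ns \<and> j < ns ! i}"
  have inj: "inj_on f (pverts G)"
  proof (rule inj_onI)
    fix u v assume "u \<in> pverts G" "v \<in> pverts G" "f u = f v"
    then show "u = v"
      using g[of "c u"] by (auto simp: f_def P_def bij_betw_def inj_on_def)
  qed
  have img: "f ` pverts G = ?V"
  proof (intro equalityI subsetI)
    fix x assume "x \<in> f ` pverts G"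
    then obtain v where v: "v \<in> pverts G" "x = f v" by blast
    then have "c v < k" using surj by blast
    moreover have "g (c v) v < card (P (c v))"
      using bij_betwE[OF g[of "c v"]] v by (auto simp: P_def)
    ultimately show "x \<in> ?V" by (auto simp: v f_def ns_def)
  next
    fix x assume "x \<in> ?V"
    then obtain i j where x: "x = (i, j)" "i < k" "j < card (P i)"
      by (auto simp: ns_def)
    then have "j \<in> g i ` P i" using g[of i] by (auto simp: bij_betw_def)
    then show "x \<in> f ` pverts G" by (force simp: x f_def P_def)
  qed
  have arcs: "map_prod f f ` parcs G = {(x, y). x \<in> ?V \<and> y \<in> ?V \<and> fst x \<noteq> fst y}"
  proof -
    have "map_prod f f ` parcs G
        = {(x, y). x \<in> f ` pverts G \<and> y \<in> f ` pverts G \<and> fst x \<noteq> fst y}"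
    proof (intro equalityI subsetI)
      fix a assume "a \<in> map_prod f f ` parcs G"
      then show "a \<in> {(x, y). x \<in> f ` pverts G \<and> y \<in> f ` pverts G \<and> fst x \<noteq> fst y}"
        using c by (auto simp: multipartite_coloring_def f_def)
    next
      fix a assume "a \<in> {(x, y). x \<in> f ` pverts G \<and> y \<in> f ` pverts G \<and> fst x \<noteq> fst y}"
      then obtain u v where uv: "u \<in> pverts G" "v \<in> pverts G" "c u \<noteq> c v" "a = map_prod f f (u, v)"
        by (auto simp: f_def)
      then have "(u, v) \<in> parcs G" using c by (simp add: multipartite_coloring_def)
      then show "a \<in> map_prod f f ` parcs G" using uv(4) by blast
    qed
    then show ?thesis by (simp only: img)
  qed
  \<comment> \<open>An isomorphism of digraphs carries the end maps of its target as well; in a graph whose arcs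
    are pairs they have to be the projections.\<close>
  define h where "h = \<lparr>iso_verts = f, iso_arcs = map_prod f f, iso_head = snd, iso_tail = fst\<rparr>"
  have "parcs G \<subseteq> pverts G \<times> pverts G" using in_arcsD1 in_arcsD2 by auto
  then have "inj_on (map_prod f f) (parcs G)"
    using map_prod_inj_on[OF inj inj] inj_on_subset by blast
  then have "pre_digraph.digraph_isomorphism (with_proj G) h"
    using inj wf_digraph by (simp add: pre_digraph.digraph_isomorphism_def h_def)
  moreover have "with_proj (complete_multipartite ns) = app_iso h (with_proj G)"
    using arcs img
    by (simp add: app_iso_def h_def complete_multipartite_def with_proj_def Let_def)
  ultimately have "digraph_iso (with_proj G) (with_proj (complete_multipartite ns))"
    by (auto simp: digraph_iso_def)
  moreover have "length ns = k" by (simp add: ns_def)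
  ultimately show ?thesis using pos by blast
qed

text \<open>
  The first component of the image of a vertex is the index of its part. Every index occurs because
  no part is empty.
\<close>

lemma iso_complete_multipartite_imp_multipartite_coloring:
  assumes "pair_wf_digraph G"
    and iso: "digraph_iso (with_proj G) (with_proj (complete_multipartite ns))"
    and pos: "\<forall>n \<in> set ns. 0 < n"
  shows "\<exists>c. multipartite_coloring G c \<and> c ` pverts G = {..<length ns}"
proof -
  interpret pair_wf_digraph G by fact
  let ?M = "complete_multipartite ns"
  obtain h where h: "pre_digraph.digraph_isomorphism (with_proj G) h"
    and M: "with_proj ?M = app_iso h (with_proj G)"
    using iso by (auto simp: digraph_iso_def)
  define f where "f = iso_verts h"
  define c where "c = fst \<circ> f"
  have "tail (with_proj ?M) = iso_tail h" "head (with_proj ?M) = iso_head h"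
    by (simp_all add: M)
  then have th: "iso_tail h = fst" "iso_head h = snd" by simp_all
  have inj: "inj_on f (pverts G)"
    using h by (simp add: pre_digraph.digraph_isomorphism_def f_def)
  have "iso_arcs h a = map_prod f f a" if "a \<in> parcs G" for a
    using h that th
    by (auto simp: pre_digraph.digraph_isomorphism_def f_def prod_eq_iff)
  then have "iso_arcs h ` parcs G = map_prod f f ` parcs G" by (rule image_cong[OF refl])
  moreover have "arcs (with_proj ?M) = iso_arcs h ` parcs G" by (simp add: M)
  ultimately have arcs: "parcs ?M = map_prod f f ` parcs G" by simp
  have "verts (with_proj ?M) = f ` pverts G" by (simp add: M f_def)
  then have verts: "pverts ?M = f ` pverts G" by simp
  have adj: "(u, v) \<in> parcs G \<longleftrightarrow> c u \<noteq> c v" if "u \<in> pverts G" "v \<in> pverts G" for u v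
  proof -
    have "(u, v) \<in> parcs G \<longleftrightarrow> (f u, f v) \<in> map_prod f f ` parcs G"
    proof
      assume "(f u, f v) \<in> map_prod f f ` parcs G"
      then obtain u' v' where "(u', v') \<in> parcs G" "f u' = f u" "f v' = f v" by auto
      moreover from this have "u' = u" "v' = v"
        using inj_onD[OF inj] that in_arcsD1 in_arcsD2 by blast+
      ultimately show "(u, v) \<in> parcs G" by simp
    qed force
    also have "\<dots> \<longleftrightarrow> (f u, f v) \<in> parcs ?M" by (simp only: arcs)
    also have "\<dots> \<longleftrightarrow> f u \<in> pverts ?M \<and> f v \<in> pverts ?M \<and> fst (f u) \<noteq> fst (f v)"
      by (simp add: complete_multipartite_def Let_def)
    finally show ?thesis using that by (simp add: verts c_def)
  qed
  have "c ` pverts G = fst ` pverts ?M" by (simp only: c_def verts image_comp)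
  also have "\<dots> = {..<length ns}"
  proof (intro equalityI subsetI)
    fix i assume "i \<in> {..<length ns}"
    then have "(i, 0) \<in> pverts ?M"
      using pos by (simp add: complete_multipartite_def Let_def)
    then show "i \<in> fst ` pverts ?M" by force
  qed (auto simp: complete_multipartite_def Let_def)
  finally have "c ` pverts G = {..<length ns}" .
  moreover have "multipartite_coloring G c"
    unfolding multipartite_coloring_def using adj in_arcsD1 in_arcsD2 by blast
  ultimately show ?thesis by blast
qed

section \<open>Characterisation of upper-critical graphs\<close>

theorem theorem11:
  fixes G :: "'a pair_pre_digraph" and k :: nat
  assumes "pair_graph G"
    and "connected (with_proj G)"
    and "chromatic_number G = k"
  shows "upper_critical G \<longleftrightarrow>
    (\<exists>ns :: nat list. length ns = k \<and> (\<forall>n \<in> set ns. 0 < n) \<and>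
       digraph_iso (with_proj G) (with_proj (complete_multipartite ns)))"
proof -
  interpret pair_graph G by fact
  have G: "pair_digraph G" "pair_wf_digraph G" by unfold_locales
  show ?thesis
  proof
    assume crit: "upper_critical G"
    obtain c where c: "proper_coloring G (chromatic_number G) c"
      using optimal_coloring_exists[OF G(1)] by blast
    show "\<exists>ns. length ns = k \<and> (\<forall>n \<in> set ns. 0 < n) \<and>
        digraph_iso (with_proj G) (with_proj (complete_multipartite ns))"
      using multipartite_coloring_imp_iso_complete_multipartite[OF G(1)
          upper_critical_imp_multipartite_coloring[OF G(1) crit c] optimal_coloring_surj[OF G(2) c]]
      by (simp add: assms(3))
  next
    assume "\<exists>ns. length ns = k \<and> (\<forall>n \<in> set ns. 0 < n) \<and>
        digraph_iso (with_proj G) (with_proj (complete_multipartite ns))"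
    then obtain c where "multipartite_coloring G c" "c ` pverts G = {..<k}"
      using iso_complete_multipartite_imp_multipartite_coloring[OF G(2)] by blast
    then show "upper_critical G"
      using multipartite_coloring_imp_upper_critical[OF G(1)] assms(3) by blast
  qed
qed

end
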